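(* Let $a\neq 0$ (lattice parameter) and $c>0$ be real constants, let $I\subset\mathbb{R}$ be an open interval with coordinate $T$, and for each integer $k\ge 0$ let $f_k,g_k:I\to\mathbb{R}$ be smooth nowhere-vanishing functions satisfying the bilinear equations $$(D_T^2+cD_T)\,g_k\cdot f_k=0\quad(k\ge0),\qquad (D_T^2+cD_T-2aD_T)\,g_k\cdot f_{k-1}=0\quad(k\ge1).$$ Define (dependent variable transformation) $$\psi_k=\frac{g_k}{f_k},\qquad u_k=(\log f_k)_{TT},\qquad \frac1{\rho_k}=1-\frac1a\left(\log\frac{f_k}{f_{k-1}}\right)_T\ (k\ge1),$$ where it is assumed that $1-\frac1a\left(\log\frac{f_k}{f_{k-1}}\right)_T$ is nowhere zero. Define (discrete hodograph transformation) $$x_k=x_0(T)+\sum_{l=1}^{k}\frac{a}{\rho_l}\qquad(k\ge 0),$$ where $x_0(T)$ is a smooth function satisfying the consistency condition $\dfrac{dx_0(T)}{dT}=-u_0(T)$, and put $\delta_k=x_k-x_{k-1}$ for $k\ge1$. Then the following semi-discrete analogue of the two-component Hunter--Saxton equation holds: for all $k\ge1$, $$\begin{aligned}\frac{d}{dT}(u_k-u_{k-1})={}&-\frac{u_k-u_{k-1}}{\delta_k}\Bigl((u_k-u_{k-1})+(\delta_k-a)(c-a-\delta_k)\Bigr)\\&+\frac{1}{2\delta_k}\Bigl((u_k-u_{k-1})+(\delta_k-a)(c-a-\delta_k)\Bigr)^2+4u_k\delta_k\\&-c\Bigl((u_k-u_{k-1})+(\delta_k-a)(c-a-\delta_k)\Bigr)-(u_k-u_{k-1})(2\delta_k-c),\end{aligned}$$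 and for all $k\ge0$, $$\frac{dx_k}{dT}=-u_k .$$
   Context: Hirota bilinear operator: for smooth functions $g,f$ of $T$, $D_T^m\,g\cdot f=\left.(\partial_T-\partial_{T'})^m g(T)f(T')\right|_{T'=T}$, extended linearly to polynomials in $D_T$. Subscript $T$ denotes $d/dT$; $(\log f_k)_T$ means $f_{k,T}/f_k$ and $\left(\log\frac{f_k}{f_{k-1}}\right)_T$ means $f_{k,T}/f_k-f_{k-1,T}/f_{k-1}$. The index $k$ is a discrete spatial site index; $u_k$ is interpreted as the value of $u$ at the mesh point $x_k$. *)

theory Defs
  imports "HOL-Analysis.Analysis" "HOL-Computational_Algebra.Polynomial"
begin

(* Intended for open I: the iterated derivatives at points of I then depend only on the
   values of h on I, so the values of h outside I are irrelevant. *)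
definition smooth_on :: "real set \<Rightarrow> (real \<Rightarrow> real) \<Rightarrow> bool" where
  "smooth_on I h \<longleftrightarrow> (\<forall>n. \<forall>t\<in>I. (deriv ^^ n) h differentiable (at t))"

(* The operator d/ds - d/dt on functions F s t of two real variables. *)
definition partial_diff :: "(real \<Rightarrow> real \<Rightarrow> real) \<Rightarrow> real \<Rightarrow> real \<Rightarrow> real" where
  "partial_diff F = (\<lambda>s t. deriv (\<lambda>s'. F s' t) s - deriv (\<lambda>t'. F s t') t)"

definition hirota_pow :: "nat \<Rightarrow> (real \<Rightarrow> real) \<Rightarrow> (real \<Rightarrow> real) \<Rightarrow> real \<Rightarrow> real" where
  "hirota_pow m g f T = (partial_diff ^^ m) (\<lambda>s t. g s * f t) T T"

(* Linear extension of the Hirota operators to polynomials in D_T; the indeterminate of p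
   stands for D_T. *)
definition hirota :: "real poly \<Rightarrow> (real \<Rightarrow> real) \<Rightarrow> (real \<Rightarrow> real) \<Rightarrow> real \<Rightarrow> real" where
  "hirota p g f T = (\<Sum>m\<le>degree p. coeff p m * hirota_pow m g f T)"

abbreviation D_T :: "real poly" where
  "D_T \<equiv> [:0, 1:]"

(* (log f)_T, read as f_T / f, so that it is meaningful for negative f as well. *)
definition log_deriv :: "(real \<Rightarrow> real) \<Rightarrow> real \<Rightarrow> real" where
  "log_deriv f T = deriv f T / f T"

end

theory Submission
  imports Defs
begin

text \<open>
  In terms of the logarithmic derivatives \<open>p, q, r\<close> of \<open>f\<^sub>k, f\<^bsub>k-1\<^esub>, g\<^sub>k\<close>, the bilinear equations
  become the Riccati equations \<open>r' + p' + (r - p)\<^sup>2 + c (r - p) = 0\<close> and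
  \<open>r' + q' + (r - q)\<^sup>2 + (c - 2 a) (r - q) = 0\<close>. With \<open>\<delta> = a - (p - q)\<close>, their difference
  is the relation \<open>(p' - q') + (\<delta> - a) (c - a - \<delta>) = - 2 (r - p) \<delta>\<close>, which involves \<open>u\<^sub>k - u\<^bsub>k-1\<^esub> = p' - q'\<close>
  algebraically. Differentiating it and eliminating \<open>(r - p)'\<close> by the first Riccati equation
  gives the claim.
\<close>

lemma smooth_on_DERIV:
  assumes "smooth_on I h" "T \<in> I"
  shows "((deriv ^^ n) h has_real_derivative (deriv ^^ Suc n) h T) (at T)"
  using assms unfolding smooth_on_def
  by (metis DERIV_deriv_iff_real_differentiable comp_apply funpow.simps(2))

lemma smooth_on_DERIV_01:
  assumes "smooth_on I h" "T \<in> I"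
  shows "(h has_real_derivative deriv h T) (at T)"
    and "(deriv h has_real_derivative deriv (deriv h) T) (at T)"
  using smooth_on_DERIV[OF assms, of 0] smooth_on_DERIV[OF assms, of 1] by simp_all

lemma log_deriv_DERIV:
  assumes "smooth_on I h" "T \<in> I" "h T \<noteq> 0"
  shows "(log_deriv h has_real_derivative deriv (deriv h) T / h T - (log_deriv h T)\<^sup>2) (at T)"
proof -
  have "((\<lambda>t. deriv h t / h t) has_real_derivative
      (deriv (deriv h) T * h T - deriv h T * deriv h T) / (h T * h T)) (at T)"
    using smooth_on_DERIV_01[OF assms(1,2)] assms(3) by (intro DERIV_divide)
  moreover have "(deriv (deriv h) T * h T - deriv h T * deriv h T) / (h T * h T)
      = deriv (deriv h) T / h T - (log_deriv h T)\<^sup>2"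
    using assms(3) by (simp add: log_deriv_def field_simps power2_eq_square)
  moreover have "log_deriv h = (\<lambda>t. deriv h t / h t)"
    by (simp add: log_deriv_def fun_eq_iff)
  ultimately show ?thesis by simp
qed

text \<open>The formula is stated off the diagonal: a second application of the operator
  differentiates in \<open>s\<close> and \<open>t\<close> separately before both are set to
  \<open>T\<close>.\<close>

lemma partial_diff_mult:
  assumes "smooth_on I g" "smooth_on I f" "s \<in> I" "t \<in> I"
  shows "partial_diff (\<lambda>s t. g s * f t) s t = deriv g s * f t - g s * deriv f t"
proof -
  have "((\<lambda>s'. g s' * f t) has_real_derivative deriv g s * f t) (at s)"
    "((\<lambda>t'. g s * f t') has_real_derivative g s * deriv f t) (at t)"
    using smooth_on_DERIV_01[OF assms(1,3)] smooth_on_DERIV_01[OF assms(2,4)]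
    by (auto intro!: derivative_eq_intros)
  then show ?thesis
    by (simp add: partial_diff_def DERIV_imp_deriv)
qed

lemma hirota_pow_1:
  assumes "smooth_on I g" "smooth_on I f" "T \<in> I"
  shows "hirota_pow 1 g f T = deriv g T * f T - g T * deriv f T"
  using partial_diff_mult[OF assms assms(3)] by (simp add: hirota_pow_def)

lemma hirota_pow_2:
  assumes "open I" "smooth_on I g" "smooth_on I f" "T \<in> I"
  shows "hirota_pow 2 g f T
    = deriv (deriv g) T * f T - 2 * deriv g T * deriv f T + g T * deriv (deriv f) T"
proof -
  let ?F = "partial_diff (\<lambda>s t. g s * f t)"
  have ev: "\<forall>\<^sub>F s in nhds T. s \<in> I"
    using assms(1,4) by (rule eventually_nhds_in_open)
  \<comment> \<open>The formula for \<open>?F\<close> is available only at points of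
    \<open>I\<close>. Since \<open>I\<close> is open, it holds near \<open>T\<close>, which suffices
    to replace the function under \<open>deriv\<close>.\<close>
  have "deriv (\<lambda>s. ?F s T) T = deriv (\<lambda>s. deriv g s * f T - g s * deriv f T) T"
    using ev by (intro deriv_cong_ev refl)
      (auto elim!: eventually_mono simp: partial_diff_mult[OF assms(2,3) _ assms(4)])
  also have "\<dots> = deriv (deriv g) T * f T - deriv g T * deriv f T"
    using smooth_on_DERIV_01[OF assms(2,4)]
    by (intro DERIV_imp_deriv) (auto intro!: derivative_eq_intros)
  finally have 1: "deriv (\<lambda>s. ?F s T) T = \<dots>" .
  have "deriv (\<lambda>t. ?F T t) T = deriv (\<lambda>t. deriv g T * f t - g T * deriv f t) T"
    using ev by (intro deriv_cong_ev refl)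
      (auto elim!: eventually_mono simp: partial_diff_mult[OF assms(2,3,4)])
  also have "\<dots> = deriv g T * deriv f T - g T * deriv (deriv f) T"
    using smooth_on_DERIV_01[OF assms(3,4)]
    by (intro DERIV_imp_deriv) (auto intro!: derivative_eq_intros)
  finally have 2: "deriv (\<lambda>t. ?F T t) T = \<dots>" .
  have "hirota_pow 2 g f T = deriv (\<lambda>s. ?F s T) T - deriv (\<lambda>t. ?F T t) T"
    by (simp add: hirota_pow_def numeral_2_eq_2 partial_diff_def[of "?F"])
  then show ?thesis
    unfolding 1 2 by simp
qed

lemma hirota_quadratic:
  "hirota [:0, b, 1:] g f T = hirota_pow 2 g f T + b * hirota_pow 1 g f T"
  by (simp add: hirota_def numeral_2_eq_2)

text \<open>Dividing by \<open>g T * f T\<close> turns the bilinear form into a Riccati expression.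
  With r = g'/g and p = f'/f, one has g''/g = r' + r^2 and f''/f = p' + p^2, and the cross term -2 r
  p completes the square (r - p)^2.\<close>

lemma hirota_quadratic_eq_0_iff:
  assumes "open I" "smooth_on I g" "smooth_on I f" "T \<in> I" "g T \<noteq> 0" "f T \<noteq> 0"
  shows "hirota [:0, b, 1:] g f T = 0 \<longleftrightarrow>
    deriv (log_deriv g) T + deriv (log_deriv f) T
      + (log_deriv g T - log_deriv f T)\<^sup>2 + b * (log_deriv g T - log_deriv f T) = 0"
proof -
  have "hirota [:0, b, 1:] g f T = g T * f T *
    (deriv (log_deriv g) T + deriv (log_deriv f) T
      + (log_deriv g T - log_deriv f T)\<^sup>2 + b * (log_deriv g T - log_deriv f T))"
    unfolding hirota_quadratic hirota_pow_1[OF assms(2,3,4)] hirota_pow_2[OF assms(1-4)]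
      DERIV_imp_deriv[OF log_deriv_DERIV[OF assms(2,4,5)]]
      DERIV_imp_deriv[OF log_deriv_DERIV[OF assms(3,4,6)]]
    using assms(5,6) by (simp add: log_deriv_def field_simps power2_eq_square)
  then show ?thesis
    using assms(5,6) by simp
qed

text \<open>Differentiability of \<open>P - Q\<close> is part of the conclusion: on the open set
  \<open>I\<close> the two Riccati equations express it through \<open>p\<close>, \<open>q\<close>,
  \<open>r\<close> alone, without their derivatives. \<open>W\<close> is the bracket that occurs
  three times in the target equation.\<close>

lemma riccati_pair_imp_hunter_saxton:
  fixes p q r \<delta> :: "real \<Rightarrow> real" and P Q R :: "real \<Rightarrow> real" and a c :: real
  assumes "open I" "T \<in> I"
    and p: "\<And>t. t \<in> I \<Longrightarrow> (p has_real_derivative P t) (at t)"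
    and q: "\<And>t. t \<in> I \<Longrightarrow> (q has_real_derivative Q t) (at t)"
    and r: "\<And>t. t \<in> I \<Longrightarrow> (r has_real_derivative R t) (at t)"
    and E1: "\<And>t. t \<in> I \<Longrightarrow> R t + P t + (r t - p t)\<^sup>2 + c * (r t - p t) = 0"
    and E2: "\<And>t. t \<in> I \<Longrightarrow> R t + Q t + (r t - q t)\<^sup>2 + (c - 2 * a) * (r t - q t) = 0"
    and d: "\<And>t. t \<in> I \<Longrightarrow> \<delta> t = a - (p t - q t)"
    and nz: "\<delta> T \<noteq> 0"
    and W: "W = (P T - Q T) + (\<delta> T - a) * (c - a - \<delta> T)"
  shows "((\<lambda>t. P t - Q t) has_real_derivative
      - ((P T - Q T) / \<delta> T) * W + 1 / (2 * \<delta> T) * W\<^sup>2 + 4 * P T * \<delta> T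
      - c * W - (P T - Q T) * (2 * \<delta> T - c)) (at T)"
proof -
  define s where "s = (\<lambda>t. r t - p t)"
  \<comment> \<open>\<open>e\<close> is given by one formula everywhere, while \<delta> is pinned
    down only on \<open>I\<close>.\<close>
  define e where "e = (\<lambda>t. a - (p t - q t))"
  define U where "U = P T - Q T"
  \<comment> \<open>Subtracting the equations cancels \<open>R t\<close>. As r - q = s + a - e, the
    shift by 2 a in the second one cancels the terms 2 a s, so \<open>s\<close> survives only in the
    product with \<open>e\<close>.\<close>
  have U_eq: "P t - Q t = - 2 * s t * e t - (e t - a) * (c - a - e t)" if "t \<in> I" for t
    using E1[OF that] E2[OF that] unfolding s_def e_def by algebra
  have dT: "\<delta> T = e T"
    using d[OF assms(2)] by (simp add: e_def)
  have s': "(s has_real_derivative R T - P T) (at T)"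
    unfolding s_def using r[OF assms(2)] p[OF assms(2)] by (rule DERIV_diff)
  have e': "(e has_real_derivative - U) (at T)"
    unfolding e_def U_def using p[OF assms(2)] q[OF assms(2)]
    by (auto intro!: derivative_eq_intros)
  have "((\<lambda>t. - 2 * s t * e t - (e t - a) * (c - a - e t)) has_real_derivative
      - 2 * (R T - P T) * e T + 2 * s T * U + U * (c - 2 * e T)) (at T)"
    using s' e' by (auto intro!: derivative_eq_intros simp: algebra_simps)
  then have deriv: "((\<lambda>t. P t - Q t) has_real_derivative
      - 2 * (R T - P T) * e T + 2 * s T * U + U * (c - 2 * e T)) (at T)"
    by (rule has_field_derivative_transform_within_open[OF _ assms(1,2)]) (simp add: U_eq)
  have W': "W = - 2 * s T * e T"
    using U_eq[OF assms(2)] by (simp add: W dT)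
  have R: "R T = - P T - (s T)\<^sup>2 - c * s T"
    using E1[OF assms(2)] by (simp add: s_def)
  \<comment> \<open>Here s = -W / (2 e), so 2 s U = -(U / e) W. By the first Riccati equation, -2 (R
    - P) e = 4 P e + 2 s^2 e + 2 c s e, whose last two terms are W^2 / (2 e) and -c W.\<close>
  have "- 2 * (R T - P T) * e T + 2 * s T * U + U * (c - 2 * e T)
      = - (U / e T) * W + 1 / (2 * e T) * W\<^sup>2 + 4 * P T * e T - c * W - U * (2 * e T - c)"
    using nz by (simp add: R W' dT field_simps power2_eq_square)
  with deriv show ?thesis
    by (simp add: dT U_def)
qed

theorem theorem2:
  fixes a c :: real and I :: "real set"
    and f g :: "nat \<Rightarrow> real \<Rightarrow> real"
    and \<psi> u \<rho> x \<delta> :: "nat \<Rightarrow> real \<Rightarrow> real"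
    and x0 :: "real \<Rightarrow> real"
  assumes a: "a \<noteq> 0" and c: "c > 0"
    and I: "open I" "is_interval I"
    and smooth: "\<And>k. smooth_on I (f k)" "\<And>k. smooth_on I (g k)"
    and nonzero: "\<And>k T. T \<in> I \<Longrightarrow> f k T \<noteq> 0" "\<And>k T. T \<in> I \<Longrightarrow> g k T \<noteq> 0"
    and bilinear1: "\<And>k T. T \<in> I \<Longrightarrow> hirota (D_T ^ 2 + smult c D_T) (g k) (f k) T = 0"
    and bilinear2: "\<And>k T. k \<ge> 1 \<Longrightarrow> T \<in> I \<Longrightarrow>
          hirota (D_T ^ 2 + smult c D_T - smult (2 * a) D_T) (g k) (f (k - 1)) T = 0"
    and psi: "\<And>k T. T \<in> I \<Longrightarrow> \<psi> k T = g k T / f k T"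
    and u: "\<And>k T. T \<in> I \<Longrightarrow> u k T = deriv (log_deriv (f k)) T"
    and rho_nonzero: "\<And>k T. k \<ge> 1 \<Longrightarrow> T \<in> I \<Longrightarrow>
          1 - 1 / a * (log_deriv (f k) T - log_deriv (f (k - 1)) T) \<noteq> 0"
    and rho: "\<And>k T. k \<ge> 1 \<Longrightarrow> T \<in> I \<Longrightarrow>
          1 / \<rho> k T = 1 - 1 / a * (log_deriv (f k) T - log_deriv (f (k - 1)) T)"
    and x: "\<And>k T. T \<in> I \<Longrightarrow> x k T = x0 T + (\<Sum>l=1..k. a / \<rho> l T)"
    and x0_smooth: "smooth_on I x0"
    and x0_consistent: "\<And>T. T \<in> I \<Longrightarrow> (x0 has_real_derivative - u 0 T) (at T)"
    and delta: "\<And>k T. k \<ge> 1 \<Longrightarrow> T \<in> I \<Longrightarrow> \<delta> k T = x k T - x (k - 1) T"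
  shows "(\<forall>k\<ge>1. \<forall>T\<in>I.
            ((\<lambda>t. u k t - u (k - 1) t) has_real_derivative
              (- ((u k T - u (k - 1) T) / \<delta> k T)
                   * ((u k T - u (k - 1) T) + (\<delta> k T - a) * (c - a - \<delta> k T))
               + 1 / (2 * \<delta> k T)
                   * ((u k T - u (k - 1) T) + (\<delta> k T - a) * (c - a - \<delta> k T))\<^sup>2
               + 4 * u k T * \<delta> k T
               - c * ((u k T - u (k - 1) T) + (\<delta> k T - a) * (c - a - \<delta> k T))
               - (u k T - u (k - 1) T) * (2 * \<delta> k T - c))) (at T))
       \<and> (\<forall>k. \<forall>T\<in>I. (x k has_real_derivative - u k T) (at T))"
proof (intro conjI allI impI ballI)
  have L: "(log_deriv (f k) has_real_derivative u k t) (at t)"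
    "(log_deriv (g k) has_real_derivative deriv (log_deriv (g k)) t) (at t)" if "t \<in> I" for k t
    using log_deriv_DERIV[OF smooth(1) that nonzero(1)[OF that], of k]
      log_deriv_DERIV[OF smooth(2) that nonzero(2)[OF that], of k]
    by (simp_all add: u[OF that] DERIV_imp_deriv)
  have inv_rho: "a / \<rho> k t = a - (log_deriv (f k) t - log_deriv (f (k - 1)) t)"
    if "k \<ge> 1" "t \<in> I" for k t
  proof -
    have "a / \<rho> k t = a * (1 - 1 / a * (log_deriv (f k) t - log_deriv (f (k - 1)) t))"
      unfolding rho[OF that, symmetric] by simp
    also have "\<dots> = a - (log_deriv (f k) t - log_deriv (f (k - 1)) t)"
      using a by (simp add: field_simps)
    finally show ?thesis .
  qed
  \<comment> \<open>The logarithmic derivatives in the sum telescope, leaving only those of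
    \<open>f k\<close> and \<open>f 0\<close>.\<close>
  have x_telescoped: "x k t = x0 t + real k * a - (log_deriv (f k) t - log_deriv (f 0) t)"
    if "t \<in> I" for k t
  proof -
    have "(\<Sum>l=1..k. a / \<rho> l t) = real k * a - (log_deriv (f k) t - log_deriv (f 0) t)"
      by (induction k) (simp_all add: inv_rho that algebra_simps)
    then show ?thesis by (simp add: x[OF that])
  qed
  \<comment> \<open>The consistency condition contributes -u_0, which cancels the u_0 left by the
    telescoped sum.\<close>
  show "(x k has_real_derivative - u k T) (at T)" if T: "T \<in> I" for k T
  proof (rule has_field_derivative_transform_within_open[OF _ I(1) T])
    show "((\<lambda>t. x0 t + real k * a - (log_deriv (f k) t - log_deriv (f 0) t))
        has_real_derivative - u k T) (at T)"
      using x0_consistent[OF T] L(1)[OF T] by (auto intro!: derivative_eq_intros)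
  qed (simp add: x_telescoped)
  fix k T assume k: "k \<ge> (1::nat)" and T: "T \<in> I"
  have delta_eq: "\<delta> k t = a - (log_deriv (f k) t - log_deriv (f (k - 1)) t)" if "t \<in> I" for t
    using k by (simp add: delta[OF k that] x_telescoped[OF that] of_nat_diff algebra_simps)
  \<comment> \<open>The mesh width is \<open>a\<close> times the factor assumed nowhere zero, so
    division by it is legitimate.\<close>
  have "\<delta> k T = a * (1 - 1 / a * (log_deriv (f k) T - log_deriv (f (k - 1)) T))"
    using a by (simp add: delta_eq[OF T] field_simps)
  then have nz: "\<delta> k T \<noteq> 0"
    using a rho_nonzero[OF k T] by simp
  have poly1: "D_T ^ 2 + smult c D_T = [:0, c, 1:]"
    by (simp add: power2_eq_square)
  have poly2: "D_T ^ 2 + smult c D_T - smult (2 * a) D_T = [:0, c - 2 * a, 1:]"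
    by (simp add: power2_eq_square)
  show "((\<lambda>t. u k t - u (k - 1) t) has_real_derivative
              (- ((u k T - u (k - 1) T) / \<delta> k T)
                   * ((u k T - u (k - 1) T) + (\<delta> k T - a) * (c - a - \<delta> k T))
               + 1 / (2 * \<delta> k T)
                   * ((u k T - u (k - 1) T) + (\<delta> k T - a) * (c - a - \<delta> k T))\<^sup>2
               + 4 * u k T * \<delta> k T
               - c * ((u k T - u (k - 1) T) + (\<delta> k T - a) * (c - a - \<delta> k T))
               - (u k T - u (k - 1) T) * (2 * \<delta> k T - c))) (at T)"
  \<comment> \<open>The roles of \<open>p\<close>, \<open>q\<close>, \<open>r\<close> are taken by
    the logarithmic derivatives of \<open>f k\<close>, \<open>f (k - 1)\<close>, \<open>g k\<close>;
    \<open>refl\<close> instantiates \<open>W\<close> with the bracket itself.\<close>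
  proof (rule riccati_pair_imp_hunter_saxton[OF I(1) T L(1) L(1) L(2) _ _ delta_eq nz refl])
    fix t assume t: "t \<in> I"
    note iff = hirota_quadratic_eq_0_iff[OF I(1) smooth(2) smooth(1) t nonzero(2)[OF t] nonzero(1)[OF t]]
    show "deriv (log_deriv (g k)) t + u k t + (log_deriv (g k) t - log_deriv (f k) t)\<^sup>2
        + c * (log_deriv (g k) t - log_deriv (f k) t) = 0"
      using bilinear1[OF t, of k] unfolding poly1 iff u[OF t] .
    show "deriv (log_deriv (g k)) t + u (k - 1) t + (log_deriv (g k) t - log_deriv (f (k - 1)) t)\<^sup>2
        + (c - 2 * a) * (log_deriv (g k) t - log_deriv (f (k - 1)) t) = 0"
      using bilinear2[OF k t] unfolding poly2 iff u[OF t] .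
  qed
qed

end
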